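(* Let $\mathbf{X}=(X_{1},\ldots,X_{n})^{T}$ be an $n\times1$ random vector and let $\boldsymbol{p},\boldsymbol{q}\in(0,1)^{n}$ with $p_{k}<q_{k}$, $k=1,\ldots,n$; assume that the quantities below are well defined. Then: (i) (Standardization) for any constant vector $\boldsymbol{\gamma}\in\mathbb{R}^{n}$, $\mathrm{MRCov}_{(\boldsymbol{p},\boldsymbol{q})}(\boldsymbol{\gamma})=\boldsymbol{0}_{n\times n}$, the $n\times n$ zero matrix; (ii) (Positive homogeneity) for any constant $c>0$, $\mathrm{MRCov}_{(\boldsymbol{p},\boldsymbol{q})}(c\mathbf{X})=c^{2}\,\mathrm{MRCov}_{(\boldsymbol{p},\boldsymbol{q})}(\mathbf{X})$; (iii) (Translation invariance) for any constant vector $\boldsymbol{\gamma}\in\mathbb{R}^{n}$, $\mathrm{MRCov}_{(\boldsymbol{p},\boldsymbol{q})}(\mathbf{X}+\boldsymbol{\gamma})=\mathrm{MRCov}_{(\boldsymbol{p},\boldsymbol{q})}(\mathbf{X})$; (iv) (Independence of risks) if $\mathbf{X}$ has independent components, then $\mathrm{MRCov}_{(\boldsymbol{p},\boldsymbol{q})}(\mathbf{X})=\mathrm{diag}(\mathrm{RV}_{(p_{1},q_{1})}(X_{1}),\ldots,\mathrm{RV}_{(p_{n},q_{n})}(X_{n}))$.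
   Context: $\mathrm{VaR}_{p}(X)=\inf\{x: P(X\le x)\ge p\}$ and $\mathrm{VaR}_{\boldsymbol{p}}(\mathbf{X})=(\mathrm{VaR}_{p_{1}}(X_{1}),\ldots,\mathrm{VaR}_{p_{n}}(X_{n}))^{T}$. Inequalities between vectors are componentwise. For a random variable $X$ and $0<p<q<1$, $\mathrm{RVaR}_{(p,q)}(X)=\mathrm{E}[X\mid \mathrm{VaR}_{p}(X)\le X\le\mathrm{VaR}_{q}(X)]$ and $\mathrm{RV}_{(p,q)}(X)=\mathrm{E}[(X-\mathrm{RVaR}_{(p,q)}(X))^{2}\mid \mathrm{VaR}_{p}(X)\le X\le\mathrm{VaR}_{q}(X)]$. For a random vector, $\mathrm{MRVaR}_{(\boldsymbol{p},\boldsymbol{q})}(\mathbf{X})=\mathrm{E}[\mathbf{X}\mid \mathrm{VaR}_{\boldsymbol{p}}(\mathbf{X})\le\mathbf{X}\le\mathrm{VaR}_{\boldsymbol{q}}(\mathbf{X})]$ and, writing $\boldsymbol{m}=\mathrm{MRVaR}_{(\boldsymbol{p},\boldsymbol{q})}(\mathbf{X})$, $\mathrm{MRCov}_{(\boldsymbol{p},\boldsymbol{q})}(\mathbf{X})=\mathrm{E}[(\mathbf{X}-\boldsymbol{m})(\mathbf{X}-\boldsymbol{m})^{T}\mid \mathrm{VaR}_{\boldsymbol{p}}(\mathbf{X})\le\mathbf{X}\le\mathrm{VaR}_{\boldsymbol{q}}(\mathbf{X})]$. A constant vector $\boldsymbol{\gamma}$ is regarded as a degenerate random vector. "Well defined"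 means that the conditioning events involved have positive probability and the conditional expectations are finite. *)

theory Defs
  imports "HOL-Probability.Probability"
begin

definition VaR :: "'w measure \<Rightarrow> real \<Rightarrow> ('w \<Rightarrow> real) \<Rightarrow> real" where
  "VaR M p X = Inf {x. measure M {\<omega> \<in> space M. X \<omega> \<le> x} \<ge> p}"

definition VaR_vec :: "'w measure \<Rightarrow> real ^ 'n \<Rightarrow> ('w \<Rightarrow> real ^ 'n) \<Rightarrow> real ^ 'n" where
  "VaR_vec M p X = (\<chi> k. VaR M (p $ k) (\<lambda>\<omega>. X \<omega> $ k))"

(* E[f | A] for an event A: the expectation under the conditional probability P( . | A),
   which is the library's uniform_measure M A. Meaningful only if measure M A > 0 and f is
   integrable with respect to uniform_measure M A. *)
definition event_cond_exp ::
    "'w measure \<Rightarrow> 'w set \<Rightarrow> ('w \<Rightarrow> 'b :: {banach, second_countable_topology}) \<Rightarrow> 'b" where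
  "event_cond_exp M A f = integral\<^sup>L (uniform_measure M A) f"

definition range_event :: "'w measure \<Rightarrow> real \<Rightarrow> real \<Rightarrow> ('w \<Rightarrow> real) \<Rightarrow> 'w set" where
  "range_event M p q X = {\<omega> \<in> space M. VaR M p X \<le> X \<omega> \<and> X \<omega> \<le> VaR M q X}"

definition RVaR :: "'w measure \<Rightarrow> real \<Rightarrow> real \<Rightarrow> ('w \<Rightarrow> real) \<Rightarrow> real" where
  "RVaR M p q X = event_cond_exp M (range_event M p q X) X"

definition RV :: "'w measure \<Rightarrow> real \<Rightarrow> real \<Rightarrow> ('w \<Rightarrow> real) \<Rightarrow> real" where
  "RV M p q X = event_cond_exp M (range_event M p q X) (\<lambda>\<omega>. (X \<omega> - RVaR M p q X)\<^sup>2)"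

(* The order on real ^ 'n is the componentwise one. *)
definition range_event_vec ::
    "'w measure \<Rightarrow> real ^ 'n \<Rightarrow> real ^ 'n \<Rightarrow> ('w \<Rightarrow> real ^ 'n) \<Rightarrow> 'w set" where
  "range_event_vec M p q X = {\<omega> \<in> space M. VaR_vec M p X \<le> X \<omega> \<and> X \<omega> \<le> VaR_vec M q X}"

definition MRVaR ::
    "'w measure \<Rightarrow> real ^ 'n \<Rightarrow> real ^ 'n \<Rightarrow> ('w \<Rightarrow> real ^ 'n) \<Rightarrow> real ^ 'n" where
  "MRVaR M p q X = event_cond_exp M (range_event_vec M p q X) X"

(* v v^T as the product of an n x 1 and a 1 x n matrix *)
definition self_outer :: "real ^ 'n \<Rightarrow> real ^ 'n ^ 'n" where
  "self_outer v = (columnvector v :: real ^ 1 ^ 'n) ** (rowvector v :: real ^ 'n ^ 1)"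

definition MRCov ::
    "'w measure \<Rightarrow> real ^ 'n \<Rightarrow> real ^ 'n \<Rightarrow> ('w \<Rightarrow> real ^ 'n) \<Rightarrow> real ^ 'n ^ 'n" where
  "MRCov M p q X =
     event_cond_exp M (range_event_vec M p q X) (\<lambda>\<omega>. self_outer (X \<omega> - MRVaR M p q X))"

definition MRCov_well_defined ::
    "'w measure \<Rightarrow> real ^ 'n \<Rightarrow> real ^ 'n \<Rightarrow> ('w \<Rightarrow> real ^ 'n) \<Rightarrow> bool" where
  "MRCov_well_defined M p q X \<longleftrightarrow>
     measure M (range_event_vec M p q X) > 0 \<and>
     integrable (uniform_measure M (range_event_vec M p q X)) X \<and>
     integrable (uniform_measure M (range_event_vec M p q X))
       (\<lambda>\<omega>. self_outer (X \<omega> - MRVaR M p q X))"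

definition diag_matrix :: "real ^ 'n \<Rightarrow> real ^ 'n ^ 'n" where
  "diag_matrix d = (\<chi> i j. if i = j then d $ i else 0)"

end

theory Submission
  imports Defs
begin

text \<open>
  Standardization, homogeneity and translation invariance are all consequences of one remark: the
  value at risk of a coordinate commutes with increasing affine maps (\<open>VaR_affine\<close>), so
  \<open>X\<close> and \<open>c *\<^sub>R X + \<gamma>\<close> are conditioned on the same event
  (\<open>range_event_vec_affine\<close>). On that event the conditional mean is mapped by the same affine map,
  the deviations from it are multiplied by \<open>c\<close>, and their outer products by \<open>c\<^sup>2\<close>
  (\<open>MRCov_affine\<close>). For a constant vector all deviations are zero.

  For independent components the point is that the conditioning event is a box: it is the
  intersection of events each of which constrains a single component. Conditioning on such a box
  keeps the components independent, and changes the law of each one exactly as conditioning on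
  its own side of the box does (\<open>prob_cond_box\<close>, \<open>indep_vars_cond_box\<close>,
  \<open>distr_cond_box\<close>). Hence the conditional means of the components are the univariate
  RVaRs, the diagonal of the covariance matrix consists of the univariate RVs, and the entries off
  the diagonal factor into products of conditional means of centred variables, which vanish.
\<close>

section \<open>Value at risk under increasing affine maps\<close>

text \<open>
  This makes the infimum that defines the value at risk one over a nonempty set that is bounded
  below: the distribution function of \<open>X\<close> tends to 1 and 0 at the two ends of the line, so it
  crosses every level strictly between them.
\<close>

lemma (in prob_space) VaR_level_set:
  fixes X :: "'a \<Rightarrow> real"
  assumes [measurable]: "X \<in> borel_measurable M" and p: "0 < p" "p < 1"
  shows "{x. prob {\<omega> \<in> space M. X \<omega> \<le> x} \<ge> p} \<noteq> {}" (is "?S \<noteq> {}")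
    and "bdd_below {x. prob {\<omega> \<in> space M. X \<omega> \<le> x} \<ge> p}"
proof -
  interpret D: real_distribution "distr M borel X"
    by (rule real_distribution_distr) simp
  have cdf: "cdf (distr M borel X) x = prob {\<omega> \<in> space M. X \<omega> \<le> x}" for x
    by (simp add: cdf_def measure_distr vimage_def Int_def conj_commute)
  have "eventually (\<lambda>x. cdf (distr M borel X) x > p) at_top"
    by (rule order_tendstoD(1)[OF D.cdf_lim_at_top_prob p(2)])
  then obtain x where "cdf (distr M borel X) x > p"
    using eventually_happens by fastforce
  then show "?S \<noteq> {}"
    by (auto simp: cdf intro: less_imp_le)
  have "eventually (\<lambda>x. cdf (distr M borel X) x < p) at_bot"
    by (rule order_tendstoD(2)[OF D.cdf_lim_at_bot p(1)])
  then obtain b where b: "\<And>x. x \<le> b \<Longrightarrow> cdf (distr M borel X) x < p"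
    by (auto simp: eventually_at_bot_linorder)
  show "bdd_below ?S"
  proof (rule bdd_belowI[of _ b])
    fix x assume "x \<in> ?S"
    then show "b \<le> x"
      using b[of x] by (force simp: cdf not_le[symmetric])
  qed
qed

lemma (in prob_space) VaR_affine:
  fixes X :: "'a \<Rightarrow> real"
  assumes X: "X \<in> borel_measurable M" and p: "0 < p" "p < 1" and c: "0 < c"
  shows "VaR M p (\<lambda>\<omega>. c * X \<omega> + b) = c * VaR M p X + b"
proof -
  let ?S = "{x. prob {\<omega> \<in> space M. X \<omega> \<le> x} \<ge> p}"
  let ?f = "\<lambda>x. c * x + b"
  have *: "prob {\<omega> \<in> space M. ?f (X \<omega>) \<le> x} = prob {\<omega> \<in> space M. X \<omega> \<le> (x - b) / c}" for x
    using c by (simp add: field_simps)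
  have "{x. prob {\<omega> \<in> space M. ?f (X \<omega>) \<le> x} \<ge> p} = ?f ` ?S"
  proof (intro equalityI subsetI)
    fix x assume "x \<in> {x. prob {\<omega> \<in> space M. ?f (X \<omega>) \<le> x} \<ge> p}"
    then show "x \<in> ?f ` ?S"
      using c unfolding * by (intro image_eqI[of _ _ "(x - b) / c"]) auto
  next
    fix x assume "x \<in> ?f ` ?S"
    then show "x \<in> {x. prob {\<omega> \<in> space M. ?f (X \<omega>) \<le> x} \<ge> p}"
      using c unfolding * by auto
  qed
  moreover have "?f (Inf ?S) = (INF s\<in>?S. ?f s)"
  proof (rule continuous_at_Inf_mono)
    show "mono ?f"
      using c by (intro monoI) simp
    show "continuous (at_right (Inf ?S)) ?f"
      by (intro continuous_intros)
  qed (use VaR_level_set[OF X p] in auto)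
  ultimately show ?thesis
    by (simp add: VaR_def)
qed

lemma (in prob_space) VaR_const:
  assumes "0 < p" "p < 1"
  shows "VaR M p (\<lambda>\<omega>. a) = a"
proof -
  have "prob {\<omega> \<in> space M. a \<le> x} = (if a \<le> x then 1 else 0)" for x
    by (simp add: prob_space)
  then have "{x. prob {\<omega> \<in> space M. a \<le> x} \<ge> p} = {a..}"
    using assms by auto
  then show ?thesis
    by (simp add: VaR_def)
qed

lemma range_event_vec_eq_INT:
  "range_event_vec M p q X = (\<Inter>k. range_event M (p $ k) (q $ k) (\<lambda>\<omega>. X \<omega> $ k))"
  by (auto simp: range_event_vec_def range_event_def VaR_vec_def less_eq_vec_def)

lemma (in prob_space) range_event_affine:
  fixes X :: "'a \<Rightarrow> real"
  assumes "X \<in> borel_measurable M" "0 < p" "p < 1" "0 < q" "q < 1" "0 < c"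
  shows "range_event M p q (\<lambda>\<omega>. c * X \<omega> + b) = range_event M p q X"
  using assms by (simp add: range_event_def VaR_affine)

lemma (in prob_space) range_event_vec_affine:
  fixes X :: "'a \<Rightarrow> real ^ 'n"
  assumes "X \<in> borel_measurable M"
    and "\<And>k. 0 < p $ k \<and> p $ k < 1" "\<And>k. 0 < q $ k \<and> q $ k < 1" "0 < c"
  shows "range_event_vec M p q (\<lambda>\<omega>. c *\<^sub>R X \<omega> + \<gamma>) = range_event_vec M p q X"
proof -
  have "(\<lambda>\<omega>. X \<omega> $ k) \<in> borel_measurable M" for k
    by (rule borel_measurable_continuous_on[OF _ assms(1)]) (intro continuous_intros)
  with assms(2-) show ?thesis
    by (simp add: range_event_vec_eq_INT range_event_affine)
qed

section \<open>The covariance of affine images\<close>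

lemma prob_space_cond:
  assumes "measure M A > 0"
  shows "prob_space (uniform_measure M A)"
  using assms by (intro prob_space_uniform_measure) (auto simp: measure_def enn2real_positive_iff)

lemma self_outer_nth: "self_outer v $ i $ j = v $ i * v $ j"
  by (simp add: self_outer_def matrix_matrix_mult_def columnvector_def rowvector_def)

lemma self_outer_scaleR: "self_outer (c *\<^sub>R v) = c\<^sup>2 *\<^sub>R self_outer v"
  by (simp add: vec_eq_iff self_outer_nth power2_eq_square)

lemma (in prob_space) MRCov_const:
  fixes \<gamma> :: "real ^ 'n"
  assumes "\<And>k. 0 < p $ k \<and> p $ k < 1" "\<And>k. 0 < q $ k \<and> q $ k < 1"
  shows "MRCov M p q (\<lambda>\<omega>. \<gamma>) = 0"
proof -
  have A: "range_event_vec M p q (\<lambda>\<omega>. \<gamma>) = space M"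
    using assms by (simp add: range_event_vec_eq_INT range_event_def VaR_const)
  interpret N: prob_space "uniform_measure M (space M)"
    by (rule prob_space_cond) (simp add: prob_space)
  have "self_outer 0 = (0 :: real ^ 'n ^ 'n)"
    by (simp add: vec_eq_iff self_outer_nth)
  moreover have "MRVaR M p q (\<lambda>\<omega>. \<gamma>) = \<gamma>"
    by (simp add: MRVaR_def event_cond_exp_def A N.prob_space[simplified])
  ultimately show ?thesis
    by (simp add: MRCov_def event_cond_exp_def)
qed

lemma (in prob_space) MRCov_affine:
  fixes X :: "'a \<Rightarrow> real ^ 'n"
  assumes X: "X \<in> borel_measurable M"
    and pq: "\<And>k. 0 < p $ k \<and> p $ k < 1" "\<And>k. 0 < q $ k \<and> q $ k < 1"
    and c: "0 < c"
    and pos: "prob (range_event_vec M p q X) > 0"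
    and int: "integrable (uniform_measure M (range_event_vec M p q X)) X"
  shows "MRCov M p q (\<lambda>\<omega>. c *\<^sub>R X \<omega> + \<gamma>) = c\<^sup>2 *\<^sub>R MRCov M p q X"
proof -
  note A = range_event_vec_affine[OF X pq c]
  interpret N: prob_space "uniform_measure M (range_event_vec M p q X)"
    by (rule prob_space_cond[OF pos])
  have "MRVaR M p q (\<lambda>\<omega>. c *\<^sub>R X \<omega> + \<gamma>) = c *\<^sub>R MRVaR M p q X + \<gamma>"
    using int by (simp add: MRVaR_def event_cond_exp_def A N.prob_space[simplified])
  then have "self_outer (c *\<^sub>R X \<omega> + \<gamma> - MRVaR M p q (\<lambda>\<omega>. c *\<^sub>R X \<omega> + \<gamma>)) =
      c\<^sup>2 *\<^sub>R self_outer (X \<omega> - MRVaR M p q X)" for \<omega>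
    by (simp add: self_outer_scaleR[symmetric] scaleR_diff_right)
  then show ?thesis
    by (simp add: MRCov_def event_cond_exp_def A)
qed

section \<open>Conditioning independent variables on a box\<close>

text \<open>
  The probability of a box factors, and the intersection of two boxes is a box. Dividing one
  factorization by the other gives a factorization of the conditional probabilities.
\<close>

lemma (in prob_space) prob_cond_box:
  assumes ind: "indep_vars S Y I" and I: "I \<noteq> {}" "finite I"
    and B: "\<And>i. i \<in> I \<Longrightarrow> B i \<in> sets (S i)" and C: "\<And>i. i \<in> I \<Longrightarrow> C i \<in> sets (S i)"
    and pos: "prob (\<Inter>i\<in>I. Y i -` B i \<inter> space M) > 0"
  shows "measure (uniform_measure M (\<Inter>i\<in>I. Y i -` B i \<inter> space M))
           (\<Inter>i\<in>I. Y i -` C i \<inter> space M)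
       = (\<Prod>i\<in>I. measure (uniform_measure M (Y i -` B i \<inter> space M)) (Y i -` C i \<inter> space M))"
proof -
  let ?A = "\<Inter>i\<in>I. Y i -` B i \<inter> space M"
  have Y: "Y i \<in> measurable M (S i)" if "i \<in> I" for i
    using ind that by (auto simp: indep_vars_def)
  have BC: "B i \<inter> C i \<in> sets (S i)" if "i \<in> I" for i
    using B C that by auto
  have A_prod: "prob ?A = (\<Prod>i\<in>I. prob (Y i -` B i \<inter> space M))"
    by (rule indep_varsD_finite[OF ind I B])
  have pos_i: "prob (Y i -` B i \<inter> space M) \<noteq> 0" if "i \<in> I" for i
    using pos that I unfolding A_prod by (metis less_irrefl prod_zero_iff)
  have "?A \<inter> (\<Inter>i\<in>I. Y i -` C i \<inter> space M) = (\<Inter>i\<in>I. Y i -` (B i \<inter> C i) \<inter> space M)"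
    using I by auto
  then have "measure (uniform_measure M ?A) (\<Inter>i\<in>I. Y i -` C i \<inter> space M)
      = prob (\<Inter>i\<in>I. Y i -` (B i \<inter> C i) \<inter> space M) / prob ?A"
    using pos C I
    by (subst measure_uniform_measure)
       (auto simp: emeasure_eq_measure simp del: INT_simps
         intro!: sets.finite_INT measurable_sets[OF Y])
  also have "\<dots> = (\<Prod>i\<in>I. prob (Y i -` (B i \<inter> C i) \<inter> space M) / prob (Y i -` B i \<inter> space M))"
    by (simp only: indep_varsD_finite[OF ind I BC] A_prod prod_dividef)
  also have "\<dots> = (\<Prod>i\<in>I. measure (uniform_measure M (Y i -` B i \<inter> space M))
                              (Y i -` C i \<inter> space M))"
  proof (rule prod.cong[OF refl])
    fix i assume i: "i \<in> I"
    have "Y i -` (B i \<inter> C i) \<inter> space M = (Y i -` B i \<inter> space M) \<inter> (Y i -` C i \<inter> space M)"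
      by auto
    then show "prob (Y i -` (B i \<inter> C i) \<inter> space M) / prob (Y i -` B i \<inter> space M)
        = measure (uniform_measure M (Y i -` B i \<inter> space M)) (Y i -` C i \<inter> space M)"
      using pos_i[OF i] measurable_sets[OF Y C, OF i i]
      by (subst measure_uniform_measure) (auto simp: emeasure_eq_measure)
  qed
  finally show ?thesis .
qed

text \<open>
  The marginal case of the factorization: all sides of the second box but one are the whole space,
  so all factors but one are equal to 1.
\<close>

lemma (in prob_space) measure_cond_box_marginal:
  assumes ind: "indep_vars S Y I" and I: "finite I" "k \<in> I"
    and B: "\<And>i. i \<in> I \<Longrightarrow> B i \<in> sets (S i)" and C: "C \<in> sets (S k)"
    and pos: "prob (\<Inter>i\<in>I. Y i -` B i \<inter> space M) > 0"
  shows "measure (uniform_measure M (\<Inter>i\<in>I. Y i -` B i \<inter> space M)) (Y k -` C \<inter> space M)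
       = measure (uniform_measure M (Y k -` B k \<inter> space M)) (Y k -` C \<inter> space M)"
proof -
  let ?A = "\<Inter>i\<in>I. Y i -` B i \<inter> space M"
  let ?C = "\<lambda>i. if i = k then C else space (S i)"
  let ?m = "\<lambda>i D. measure (uniform_measure M (Y i -` B i \<inter> space M)) (Y i -` D \<inter> space M)"
  have Y: "Y i \<in> measurable M (S i)" if "i \<in> I" for i
    using ind that by (auto simp: indep_vars_def)
  have "?m i (?C i) = 1" if "i \<in> I - {k}" for i
  proof -
    have "prob ?A \<le> prob (Y i -` B i \<inter> space M)"
      using that B I by (intro finite_measure_mono) (auto intro!: measurable_sets[OF Y])
    then interpret N: prob_space "uniform_measure M (Y i -` B i \<inter> space M)"
      using pos by (intro prob_space_cond) simp
    have "Y i -` space (S i) \<inter> space M = space M"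
      using that measurable_space[OF Y] by auto
    then show ?thesis
      using that N.prob_space by simp
  qed
  then have "?m k C = (\<Prod>i\<in>I. ?m i (?C i))"
    using I by (simp add: prod.remove[of I k])
  also have "\<dots> = measure (uniform_measure M ?A) (\<Inter>i\<in>I. Y i -` ?C i \<inter> space M)"
    using I B C pos by (intro prob_cond_box[OF ind, symmetric]) auto
  also have "(\<Inter>i\<in>I. Y i -` ?C i \<inter> space M) = Y k -` C \<inter> space M"
    using I measurable_space[OF Y] by (auto split: if_splits)
  finally show ?thesis ..
qed

lemma (in prob_space) distr_cond_box:
  assumes ind: "indep_vars S Y I" and I: "finite I" "k \<in> I"
    and B: "\<And>i. i \<in> I \<Longrightarrow> B i \<in> sets (S i)"
    and pos: "prob (\<Inter>i\<in>I. Y i -` B i \<inter> space M) > 0"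
  shows "distr (uniform_measure M (\<Inter>i\<in>I. Y i -` B i \<inter> space M)) (S k) (Y k)
       = distr (uniform_measure M (Y k -` B k \<inter> space M)) (S k) (Y k)"
    (is "distr ?N _ _ = distr ?N' _ _")
proof (rule measure_eqI)
  have Y: "Y i \<in> measurable M (S i)" if "i \<in> I" for i
    using ind that by (auto simp: indep_vars_def)
  have "prob (\<Inter>i\<in>I. Y i -` B i \<inter> space M) \<le> prob (Y k -` B k \<inter> space M)"
    using I B by (intro finite_measure_mono) (auto intro!: measurable_sets[OF Y])
  then interpret N': prob_space ?N'
    using pos by (intro prob_space_cond) simp
  interpret N: prob_space ?N
    by (rule prob_space_cond[OF pos])
  have Yk: "Y k \<in> measurable ?N (S k)" "Y k \<in> measurable ?N' (S k)"
    using Y[OF I(2)] by (simp_all cong: measurable_cong_sets)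
  fix C assume "C \<in> sets (distr ?N (S k) (Y k))"
  then have C: "C \<in> sets (S k)"
    by simp
  show "emeasure (distr ?N (S k) (Y k)) C = emeasure (distr ?N' (S k) (Y k)) C"
    using measure_cond_box_marginal[OF ind I B C pos] C Yk
    by (simp add: emeasure_distr N.emeasure_eq_measure N'.emeasure_eq_measure del: INT_simps)
qed simp

text \<open>
  The joint conditional probability of a box is a product of factors that depend on one variable
  each, and the marginal case identifies each factor with the probability of one side of the box
  given the whole conditioning event.
\<close>

lemma (in prob_space) indep_vars_cond_box:
  assumes ind: "indep_vars S Y I" and I: "I \<noteq> {}" "finite I"
    and B: "\<And>i. i \<in> I \<Longrightarrow> B i \<in> sets (S i)"
    and pos: "prob (\<Inter>i\<in>I. Y i -` B i \<inter> space M) > 0"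
  shows "prob_space.indep_vars (uniform_measure M (\<Inter>i\<in>I. Y i -` B i \<inter> space M)) S Y I"
proof -
  let ?N = "uniform_measure M (\<Inter>i\<in>I. Y i -` B i \<inter> space M)"
  interpret N: prob_space ?N
    by (rule prob_space_cond[OF pos])
  have Y: "Y i \<in> measurable M (S i)" if "i \<in> I" for i
    using ind that by (auto simp: indep_vars_def)
  have "N.indep_sets (\<lambda>i. {Y i -` C \<inter> space ?N | C. C \<in> sets (S i)}) I"
  proof (subst N.indep_sets_finite[OF I])
    fix i assume i: "i \<in> I"
    show "{Y i -` C \<inter> space ?N | C. C \<in> sets (S i)} \<subseteq> N.events"
      using measurable_sets[OF Y[OF i]] by auto
    have "space ?N = Y i -` space (S i) \<inter> space ?N"
      using measurable_space[OF Y[OF i]] by auto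
    then show "space ?N \<in> {Y i -` C \<inter> space ?N | C. C \<in> sets (S i)}"
      by blast
  next
    show "\<forall>A\<in>Pi I (\<lambda>i. {Y i -` C \<inter> space ?N | C. C \<in> sets (S i)}).
        N.prob (\<Inter>j\<in>I. A j) = (\<Prod>j\<in>I. N.prob (A j))"
    proof
      fix A assume "A \<in> Pi I (\<lambda>i. {Y i -` C \<inter> space ?N | C. C \<in> sets (S i)})"
      then have "\<forall>i\<in>I. \<exists>C. C \<in> sets (S i) \<and> A i = Y i -` C \<inter> space M"
        by (auto simp: Pi_def)
      then obtain C where C: "\<And>i. i \<in> I \<Longrightarrow> C i \<in> sets (S i)"
          and A: "\<And>i. i \<in> I \<Longrightarrow> A i = Y i -` C i \<inter> space M"
        by metis
      have "N.prob (\<Inter>j\<in>I. A j) = N.prob (\<Inter>j\<in>I. Y j -` C j \<inter> space M)"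
        using A by simp
      also have "\<dots> = (\<Prod>j\<in>I. measure (uniform_measure M (Y j -` B j \<inter> space M))
                                   (Y j -` C j \<inter> space M))"
        by (rule prob_cond_box[OF ind I B C pos])
      also have "\<dots> = (\<Prod>j\<in>I. N.prob (A j))"
        using A C I by (intro prod.cong) (simp_all add: measure_cond_box_marginal[OF ind _ _ B _ pos] del: INT_simps)
      finally show "N.prob (\<Inter>j\<in>I. A j) = (\<Prod>j\<in>I. N.prob (A j))" .
    qed
  qed
  moreover have "Y i \<in> measurable ?N (S i)" if "i \<in> I" for i
    using Y[OF that] by (simp cong: measurable_cong_sets)
  ultimately show ?thesis
    by (simp add: N.indep_vars_def2 del: INT_simps)
qed

section \<open>The covariance of independent components\<close>

lemma (in prob_space) indep_vars_integral_mult_centred: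
  fixes Y :: "'i \<Rightarrow> 'a \<Rightarrow> real"
  assumes ind: "indep_vars (\<lambda>_. borel) Y I" and ij: "i \<in> I" "j \<in> I" "i \<noteq> j"
    and int: "integrable M (Y i)" "integrable M (Y j)"
  shows "expectation (\<lambda>\<omega>. (Y i \<omega> - expectation (Y i)) * (Y j \<omega> - expectation (Y j))) = 0"
proof -
  let ?Z = "\<lambda>k \<omega>. Y k \<omega> - expectation (Y k)"
  have "indep_vars (\<lambda>_. borel) ?Z {i, j}"
    using ij
    by (intro indep_vars_compose2[OF indep_vars_subset[OF ind], where Y = "\<lambda>k x. x - expectation (Y k)"])
      auto
  then have "expectation (\<lambda>\<omega>. \<Prod>k\<in>{i, j}. ?Z k \<omega>) = (\<Prod>k\<in>{i, j}. expectation (?Z k))"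
    using int by (intro indep_vars_lebesgue_integral) auto
  then show ?thesis
    using ij int by (simp add: prob_space)
qed

text \<open>
  Under the conditional probability the components are still independent, and each has the law that
  enters the univariate RVaR and RV. The mean vector can therefore be replaced by the vector of
  the univariate RVaRs, after which the two kinds of entries are read off separately.
\<close>

lemma (in prob_space) MRCov_indep:
  fixes X :: "'a \<Rightarrow> real ^ 'n"
  assumes ind: "indep_vars (\<lambda>_. borel) (\<lambda>k \<omega>. X \<omega> $ k) UNIV"
    and wd: "MRCov_well_defined M p q X"
  shows "MRCov M p q X = diag_matrix (\<chi> k. RV M (p $ k) (q $ k) (\<lambda>\<omega>. X \<omega> $ k))"
proof -
  let ?Y = "\<lambda>k \<omega>. X \<omega> $ k"
  let ?A = "range_event_vec M p q X"
  let ?Ak = "\<lambda>k. range_event M (p $ k) (q $ k) (?Y k)"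
  let ?N = "uniform_measure M ?A"
  let ?m = "MRVaR M p q X"
  define B where "B k = {VaR M (p $ k) (?Y k)..VaR M (q $ k) (?Y k)}" for k
  have Y [measurable]: "?Y k \<in> borel_measurable M" for k
    using ind by (auto simp: indep_vars_def)
  have Ak: "?Ak k = ?Y k -` B k \<inter> space M" for k
    by (auto simp: range_event_def B_def)
  have A: "?A = (\<Inter>k\<in>UNIV. ?Y k -` B k \<inter> space M)"
    unfolding range_event_vec_eq_INT Ak ..
  have B: "B k \<in> sets borel" for k
    by (simp add: B_def)
  have pos: "prob ?A > 0" and int: "integrable ?N X"
    and int2: "integrable ?N (\<lambda>\<omega>. self_outer (X \<omega> - ?m))"
    using wd by (auto simp: MRCov_well_defined_def)
  interpret N: prob_space ?N
    by (rule prob_space_cond[OF pos])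
  have indN: "N.indep_vars (\<lambda>_. borel) ?Y UNIV"
    using indep_vars_cond_box[OF ind _ _ B] pos unfolding A by simp
  have law: "distr ?N borel (?Y k) = distr (uniform_measure M (?Ak k)) borel (?Y k)" for k
    using distr_cond_box[OF ind _ _ B, of k] pos unfolding A Ak by simp
  have cond_exp: "N.expectation (\<lambda>\<omega>. f (?Y k \<omega>)) = event_cond_exp M (?Ak k) (\<lambda>\<omega>. f (?Y k \<omega>))"
    if [measurable]: "f \<in> borel_measurable borel" for f :: "real \<Rightarrow> real" and k
  proof -
    have "N.expectation (\<lambda>\<omega>. f (?Y k \<omega>)) = integral\<^sup>L (distr ?N borel (?Y k)) f"
      by (subst integral_distr) (simp_all cong: measurable_cong_sets)
    also have "\<dots> = event_cond_exp M (?Ak k) (\<lambda>\<omega>. f (?Y k \<omega>))"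
      unfolding law event_cond_exp_def
      by (subst integral_distr) (simp_all cong: measurable_cong_sets)
    finally show ?thesis .
  qed
  have intY: "integrable ?N (?Y k)" for k
    by (rule integrable_bounded_linear[OF bounded_linear_vec_nth int])
  have m: "?m $ k = N.expectation (?Y k)" for k
    using integral_bounded_linear[OF bounded_linear_vec_nth int, of k]
    by (simp add: MRVaR_def event_cond_exp_def)
  have entry: "MRCov M p q X $ i $ j =
      N.expectation (\<lambda>\<omega>. (?Y i \<omega> - ?m $ i) * (?Y j \<omega> - ?m $ j))" for i j
  proof -
    have "bounded_linear (\<lambda>v :: real ^ 'n ^ 'n. v $ i $ j)"
      using bounded_linear_compose[OF bounded_linear_vec_nth bounded_linear_vec_nth] .
    from integral_bounded_linear[OF this int2] show ?thesis
      by (simp add: MRCov_def event_cond_exp_def self_outer_nth)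
  qed
  have "MRCov M p q X $ i $ j = (if i = j then RV M (p $ i) (q $ i) (?Y i) else 0)" for i j
  proof (cases "i = j")
    case True
    have "?m $ i = RVaR M (p $ i) (q $ i) (?Y i)"
      using cond_exp[of "\<lambda>x. x" i] by (simp add: m RVaR_def)
    then show ?thesis
      using True cond_exp[of "\<lambda>x. (x - ?m $ i)\<^sup>2" i]
      by (simp add: entry RV_def power2_eq_square)
  next
    case False
    then show ?thesis
      using N.indep_vars_integral_mult_centred[OF indN _ _ False intY intY] by (simp add: entry m)
  qed
  then show ?thesis
    by (simp add: vec_eq_iff diag_matrix_def)
qed

theorem proposition2:
  fixes M :: "'w measure" and X :: "'w \<Rightarrow> real ^ 'n" and p q :: "real ^ 'n"
  assumes "prob_space M"
    and "X \<in> borel_measurable M"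
    and "\<forall>k. 0 < p $ k \<and> p $ k < 1"
    and "\<forall>k. 0 < q $ k \<and> q $ k < 1"
    and "\<forall>k. p $ k < q $ k"
    and "MRCov_well_defined M p q X"
  shows "(\<forall>\<gamma> :: real ^ 'n. MRCov M p q (\<lambda>\<omega>. \<gamma>) = 0)
    \<and> (\<forall>c :: real. c > 0 \<longrightarrow> MRCov M p q (\<lambda>\<omega>. c *\<^sub>R X \<omega>) = c\<^sup>2 *\<^sub>R MRCov M p q X)
    \<and> (\<forall>\<gamma> :: real ^ 'n. MRCov M p q (\<lambda>\<omega>. X \<omega> + \<gamma>) = MRCov M p q X)
    \<and> (prob_space.indep_vars M (\<lambda>_. borel) (\<lambda>k \<omega>. X \<omega> $ k) UNIV \<longrightarrow>
        MRCov M p q X = diag_matrix (\<chi> k. RV M (p $ k) (q $ k) (\<lambda>\<omega>. X \<omega> $ k)))"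
proof -
  interpret prob_space M by fact
  have pq: "\<And>k. 0 < p $ k \<and> p $ k < 1" "\<And>k. 0 < q $ k \<and> q $ k < 1"
    using assms by auto
  have affine: "MRCov M p q (\<lambda>\<omega>. c *\<^sub>R X \<omega> + \<gamma>) = c\<^sup>2 *\<^sub>R MRCov M p q X" if "c > 0" for c :: real and \<gamma> :: "real ^ 'n"
    using assms pq that by (intro MRCov_affine) (auto simp: MRCov_well_defined_def)
  have "\<forall>\<gamma>. MRCov M p q (\<lambda>\<omega>. \<gamma>) = 0"
    using MRCov_const[OF pq] by blast
  moreover have "\<forall>c>0. MRCov M p q (\<lambda>\<omega>. c *\<^sub>R X \<omega>) = c\<^sup>2 *\<^sub>R MRCov M p q X"
    using affine[of _ 0] by simp
  moreover have "\<forall>\<gamma>. MRCov M p q (\<lambda>\<omega>. X \<omega> + \<gamma>) = MRCov M p q X"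
    using affine[of 1] by simp
  ultimately show ?thesis
    using MRCov_indep[OF _ assms(6)] by blast
qed

end
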